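(* Let $G=(V,E)$ be a finite, connected graph with at least two vertices. Let $v_0 \in V$ be arbitrary and consider the random walk $(v_k)_{k \ge 0}$ started in $v_0$, where $v_{k+1}$ is chosen uniformly at random from the neighbors of $v_k$. Let $T$ be the smallest time $T \geq 0$ such that $v_T \in \partial G$. Then $$ \mathbb{E}\, T \leq \max_{v \in V} \deg(v) \cdot \mathrm{diam}(G)^2.$$
   Context: Graphs are undirected and simple; $d(\cdot,\cdot)$ is the graph (shortest path) distance, $\deg(v)$ is the number of neighbors of $v$, and $\mathrm{diam}(G)=\max_{u,v\in V} d(u,v)$. The boundary $\partial G \subseteq V$ is defined as follows: $v \in \partial G$ if and only if there exists another vertex $w \in V$ such that $$ \frac{1}{\deg(v)} \sum_{(v,x) \in E} d(x,w) < d(v,w),$$ where the sum runs over all neighbors $x$ of $v$. *)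

theory Defs
  imports
    "HOL-Probability.Probability"
    "Graph_Theory.Digraph_Component"
    "Graph_Theory.Shortest_Path"
begin

text \<open>
  A finite simple undirected graph is the locale \<^locale>\<open>graph\<close>: a finite symmetric digraph
  without loops or parallel arcs. Each undirected edge is a pair of opposite arcs, so
  \<^const>\<open>out_degree\<close> counts the neighbours of a vertex, each once.
\<close>

definition neighbors :: "('a, 'b) pre_digraph \<Rightarrow> 'a \<Rightarrow> 'a set" where
  "neighbors G v = {x. v \<rightarrow>\<^bsub>G\<^esub> x}"

text \<open>
  The coercion loses nothing in a connected graph, where the shortest-path value with unit
  weights is finite; in general it would send \<open>\<infinity>\<close> to \<open>0\<close>.
\<close>

definition gdist :: "('a, 'b) pre_digraph \<Rightarrow> 'a \<Rightarrow> 'a \<Rightarrow> real" where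
  "gdist G u v = real_of_ereal (wf_digraph.\<mu> G (\<lambda>_. 1) u v)"

definition diam :: "('a, 'b) pre_digraph \<Rightarrow> real" where
  "diam G = Max {gdist G u v | u v. u \<in> verts G \<and> v \<in> verts G}"

definition max_degree :: "('a, 'b) pre_digraph \<Rightarrow> nat" where
  "max_degree G = Max (out_degree G ` verts G)"

definition boundary :: "('a, 'b) pre_digraph \<Rightarrow> 'a set" where
  "boundary G = {v \<in> verts G. \<exists>w \<in> verts G. w \<noteq> v \<and>
     1 / real (out_degree G v) * (\<Sum>x\<in>neighbors G v. gdist G x w) < gdist G v w}"

text \<open>
  \<open>X\<close> is a simple random walk on \<open>G\<close> from \<open>v\<^sub>0\<close>: given any history
  \<open>X\<^sub>0 = x\<^sub>0, \<dots>, X\<^sub>n = x\<^sub>n\<close> of positive probability, \<open>X\<^sub>n\<^sub>+\<^sub>1\<close> is uniform on the neighbours of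
  \<open>x\<^sub>n\<close>. This fixes the law of the process, not the probability space carrying it.
\<close>

definition random_walk ::
    "('a, 'b) pre_digraph \<Rightarrow> 'a \<Rightarrow> 'w measure \<Rightarrow> (nat \<Rightarrow> 'w \<Rightarrow> 'a) \<Rightarrow> bool" where
  "random_walk G v\<^sub>0 M X \<longleftrightarrow>
     prob_space M \<and>
     (\<forall>k. X k \<in> M \<rightarrow>\<^sub>M count_space (verts G)) \<and>
     (AE \<omega> in M. X 0 \<omega> = v\<^sub>0) \<and>
     (\<forall>n x y. \<P>(\<omega> in M. \<forall>i\<le>n. X i \<omega> = x i) > 0 \<longrightarrow>
        \<P>(\<omega> in M. X (Suc n) \<omega> = y \<bar> \<forall>i\<le>n. X i \<omega> = x i)
          = pmf (pmf_of_set (neighbors G (x n))) y)"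

text \<open>The value is \<open>\<infinity>\<close> on trajectories that never enter \<open>A\<close>.\<close>

definition hitting_time :: "(nat \<Rightarrow> 'w \<Rightarrow> 'a) \<Rightarrow> 'a set \<Rightarrow> 'w \<Rightarrow> enat" where
  "hitting_time X A \<omega> = (INF k\<in>{k. X k \<omega> \<in> A}. enat k)"

end

theory Submission
  imports Defs
begin

text \<open>
  Why the bound holds. Write \<open>d(v)\<close> for the distance from \<open>v\<close> to the starting vertex \<open>v\<^sub>0\<close>, and
  let \<open>\<Delta>\<close> be the maximal degree and \<open>D\<close> the diameter. Expanding
  \<open>d(x)\<^sup>2 = d(v)\<^sup>2 + 2 d(v) (d(x) - d(v)) + (d(x) - d(v))\<^sup>2\<close> and averaging over the neighbours \<open>x\<close>
  of a vertex \<open>v\<close> outside the boundary, the linear term has nonnegative mean: it vanishes for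
  \<open>v = v\<^sub>0\<close>, and otherwise this is what \<open>v\<close> not being a boundary vertex says. The quadratic term has mean at least \<open>1/deg(v) \<ge> 1/\<Delta>\<close>,
  because some neighbour is one step closer to \<open>v\<^sub>0\<close> (or \<open>v = v\<^sub>0\<close> and all neighbours are one
  step away). This is \<open>sum_squared_gdist_neighbors_ge\<close>. So, until it reaches the boundary,
  the walk gains at least \<open>1/\<Delta>\<close> in expected squared distance per step; but the squared distance
  never exceeds \<open>D\<^sup>2\<close>, so the expected number of such steps is at most \<open>\<Delta> D\<^sup>2\<close>.

  To make this precise, the potential \<open>\<phi> v = \<Delta> (D\<^sup>2 - d(v)\<^sup>2)\<close> is nonnegative and drops by at
  least \<open>1\<close> on average in every step outside the boundary, so its initial value bounds the
  expected hitting time (\<open>expected_hitting_time_le_potential\<close>, a form of Foster's criterion).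
  The proof of that criterion is a computation with finite sums: with
  \<open>p n v\<close> the probability that the target has been avoided up to time \<open>n\<close> and the walk is then
  at \<open>v\<close>, the number \<open>\<Phi> n = (\<Sum>v. p n v * \<phi> v)\<close> decreases by at least the probability that the
  hitting time exceeds \<open>n\<close>, and the sum of these probabilities over \<open>n\<close> is its expectation.
\<close>

section \<open>Neighbourhoods and distances\<close>

lemma (in wf_digraph) neighbors_eq_head_out_arcs: "neighbors G v = head G ` out_arcs G v"
  by (auto simp: neighbors_def arcs_ends_def arc_to_ends_def)

lemma (in digraph) finite_neighbors: "finite (neighbors G v)"
  by (simp add: neighbors_eq_head_out_arcs finite_out_arcs)

lemma (in digraph) card_neighbors: "card (neighbors G v) = out_degree G v"
proof -
  have "inj_on (head G) (out_arcs G v)"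
    by (rule inj_onI) (auto intro!: no_multi_arcs simp: arc_to_ends_def)
  then show ?thesis
    by (simp add: neighbors_eq_head_out_arcs card_image out_degree_def)
qed

lemma (in wf_digraph) neighbors_subset_verts: "neighbors G v \<subseteq> verts G"
  by (auto simp: neighbors_eq_head_out_arcs)

lemma (in wf_digraph) gdist_awalk_bounds:
  assumes "awalk u p v"
  shows "gdist G u v \<le> real (length p)" and "0 \<le> gdist G u v"
proof -
  have cost: "awalk_cost (\<lambda>_. 1) q = real (length q)" for q
    by (induction q) auto
  have "\<mu> (\<lambda>_. 1) u v \<le> ereal (real (length p))"
    using min_cost_le_walk_cost[OF assms, of "\<lambda>_. 1"] by (simp add: cost)
  moreover have "0 \<le> \<mu> (\<lambda>_. 1) u v"
    unfolding \<mu>_def by (intro INF_greatest) (simp add: cost)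
  ultimately show "gdist G u v \<le> real (length p)" "0 \<le> gdist G u v"
    unfolding gdist_def by (cases "\<mu> (\<lambda>_. 1) u v"; simp)+
qed

lemma (in fin_digraph) gdist_attained:
  assumes "u \<rightarrow>\<^sup>*\<^bsub>G\<^esub> v"
  obtains p where "awalk u p v" "gdist G u v = real (length p)"
proof -
  have cost: "awalk_cost (\<lambda>_. 1) q = real (length q)" for q
    by (induction q) auto
  obtain p where "apath u p v" "\<mu> (\<lambda>_. 1) u v = awalk_cost (\<lambda>_. 1) p"
    using min_cost_awalk[OF assms, of "\<lambda>_. 1"] by auto
  then show thesis
    by (intro that[of p]) (auto simp: gdist_def cost awalkI_apath)
qed

lemma (in wf_digraph) gdist_self:
  assumes "v \<in> verts G"
  shows "gdist G v v = 0"
  using gdist_awalk_bounds[of v "[]" v] assms by (simp add: awalk_Nil_iff)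

text \<open>
  The first arc of a shortest walk leads to such a neighbour.
\<close>

lemma (in fin_digraph) exists_closer_neighbor:
  assumes "v \<rightarrow>\<^sup>*\<^bsub>G\<^esub> w" "v \<noteq> w"
  obtains x where "x \<in> neighbors G v" "gdist G x w \<le> gdist G v w - 1"
proof -
  obtain p where p: "awalk v p w" "gdist G v w = real (length p)"
    using gdist_attained[OF assms(1)] .
  then obtain e q where "p = e # q"
    using assms(2) by (cases p) (auto simp: awalk_Nil_iff)
  then have "e \<in> arcs G" "tail G e = v" "awalk (head G e) q w"
    using p(1) by (auto simp: awalk_Cons_iff)
  then show thesis
    using gdist_awalk_bounds(1)[of "head G e" q w] p(2) \<open>p = e # q\<close>
    by (intro that[of "head G e"]) (auto simp: neighbors_eq_head_out_arcs)
qed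

section \<open>Growth of the squared distance\<close>

text \<open>
  This is what makes the squared distance grow strictly. For \<open>v \<noteq> w\<close> a neighbour closer to \<open>w\<close>
  serves; for \<open>v = w\<close> any neighbour \<open>x\<close> does, since it differs from \<open>v\<close> and so has distance at
  least \<open>1\<close>. Two vertices are required because an isolated vertex has no neighbour at all.
\<close>

lemma (in graph) exists_neighbor_at_other_distance:
  assumes sc: "strongly_connected G" and "card (verts G) \<ge> 2"
    and v: "v \<in> verts G" and w: "w \<in> verts G"
  shows "\<exists>x\<in>neighbors G v. 1 \<le> (gdist G x w - gdist G v w)\<^sup>2"
proof (cases "v = w")
  case False
  have "v \<rightarrow>\<^sup>*\<^bsub>G\<^esub> w" using sc v w by auto
  then obtain x where x: "x \<in> neighbors G v" "gdist G x w \<le> gdist G v w - 1"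
    using exists_closer_neighbor False by blast
  then have "1\<^sup>2 \<le> (gdist G v w - gdist G x w)\<^sup>2"
    by (intro power_mono) auto
  then show ?thesis using x(1) by (auto simp: power2_commute)
next
  case True
  have "verts G \<noteq> {v}" using assms(2) by auto
  then obtain u where u: "u \<in> verts G" "u \<noteq> v" using v by auto
  then have "v \<rightarrow>\<^sup>*\<^bsub>G\<^esub> u" using sc v by auto
  then obtain x where x: "x \<in> neighbors G v"
    using exists_closer_neighbor u(2) by metis
  then have "x \<noteq> v" "x \<in> verts G"
    using no_loops by (auto simp: neighbors_eq_head_out_arcs) 
  then have "x \<rightarrow>\<^sup>*\<^bsub>G\<^esub> v" using sc v by auto
  \<comment> \<open>The neighbour \<open>y\<close> of \<open>x\<close> closer to \<open>v\<close> witnesses that \<open>gdist G x v\<close> is at least \<open>1\<close>.\<close>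
  then obtain y where y: "y \<in> neighbors G x" "gdist G y v \<le> gdist G x v - 1"
    using exists_closer_neighbor \<open>x \<noteq> v\<close> by metis
  then have "y \<in> verts G" using neighbors_subset_verts by auto
  then have "y \<rightarrow>\<^sup>*\<^bsub>G\<^esub> v" using sc v by auto
  then have "0 \<le> gdist G y v"
    using gdist_awalk_bounds(2) by (auto simp: reachable_awalk)
  then have "1\<^sup>2 \<le> (gdist G x v)\<^sup>2" using y by (intro power_mono) auto
  then show ?thesis using x v True by (auto simp: gdist_self)
qed

text \<open>
  The gain of at least \<open>1\<close> in the sum, hence \<open>1/deg(v)\<close> in the mean, is the quadratic term of a
  single neighbour at another distance from \<open>w\<close>. The linear term is controlled by the definition
  of the boundary, which speaks of \<open>w \<noteq> v\<close> only; for \<open>w = v\<close> its coefficient \<open>gdist G v w\<close>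
  vanishes.
\<close>

lemma (in graph) sum_squared_gdist_neighbors_ge:
  assumes sc: "strongly_connected G" and "card (verts G) \<ge> 2"
    and v: "v \<in> verts G" "v \<notin> boundary G" and w: "w \<in> verts G"
  shows "real (out_degree G v) * (gdist G v w)\<^sup>2 + 1 \<le> (\<Sum>x\<in>neighbors G v. (gdist G x w)\<^sup>2)"
proof -
  let ?N = "neighbors G v" and ?d = "\<lambda>x. gdist G x w"
  obtain x where x: "x \<in> ?N" "1 \<le> (?d x - ?d v)\<^sup>2"
    using exists_neighbor_at_other_distance[OF assms(1-3) w] by auto
  have deg_pos: "0 < out_degree G v"
    using x(1) finite_neighbors card_neighbors card_gt_0_iff by (metis empty_iff)
  have "v \<rightarrow>\<^sup>*\<^bsub>G\<^esub> w" using sc v w by auto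
  then have "0 \<le> ?d v" using gdist_awalk_bounds(2) by (auto simp: reachable_awalk)
  have first_order: "0 \<le> ?d v * (\<Sum>x\<in>?N. ?d x - ?d v)"
  proof (cases "v = w")
    case True
    then show ?thesis using v by (simp add: gdist_self)
  next
    case False
    then have "?d v \<le> 1 / real (out_degree G v) * (\<Sum>x\<in>?N. ?d x)"
      using v w by (auto simp: boundary_def not_less)
    then have "0 \<le> (\<Sum>x\<in>?N. ?d x - ?d v)"
      using deg_pos by (simp add: sum_subtractf card_neighbors field_simps)
    then show ?thesis using \<open>0 \<le> ?d v\<close> by simp
  qed
  have "(?d x - ?d v)\<^sup>2 \<le> (\<Sum>x\<in>?N. (?d x - ?d v)\<^sup>2)"
    using x(1) finite_neighbors by (intro member_le_sum) auto
  then have second_order: "1 \<le> (\<Sum>x\<in>?N. (?d x - ?d v)\<^sup>2)" using x(2) by simp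
  have "(\<Sum>x\<in>?N. (?d x)\<^sup>2) = (\<Sum>x\<in>?N. (?d v)\<^sup>2 + 2 * (?d v * (?d x - ?d v)) + (?d x - ?d v)\<^sup>2)"
    by (intro sum.cong) (auto simp: power2_eq_square algebra_simps)
  also have "\<dots> = real (out_degree G v) * (?d v)\<^sup>2 + 2 * (?d v * (\<Sum>x\<in>?N. ?d x - ?d v))
      + (\<Sum>x\<in>?N. (?d x - ?d v)\<^sup>2)"
    by (simp only: sum.distrib sum_distrib_left[symmetric] sum_constant card_neighbors)
  finally show ?thesis using first_order second_order by simp
qed

section \<open>Hitting times of a random walk\<close>

text \<open>
  The tail formula for the expectation: the hitting time exceeds \<open>n\<close> exactly if \<open>A\<close> is avoided
  at all times up to \<open>n\<close>.
\<close>

lemma nn_integral_hitting_time: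
  assumes "\<And>k. {\<omega> \<in> space M. X k \<omega> \<in> A} \<in> sets M"
  shows "(\<integral>\<^sup>+ \<omega>. ennreal_of_enat (hitting_time X A \<omega>) \<partial>M)
    = (\<Sum>n. emeasure M {\<omega> \<in> space M. \<forall>i\<le>n. X i \<omega> \<notin> A})"
proof -
  have less_iff: "enat n < hitting_time X A \<omega> \<longleftrightarrow> (\<forall>i\<le>n. X i \<omega> \<notin> A)" for n \<omega>
  proof
    show "\<forall>i\<le>n. X i \<omega> \<notin> A" if "enat n < hitting_time X A \<omega>"
    proof (intro allI impI notI)
      fix i assume "i \<le> n" "X i \<omega> \<in> A"
      then have "hitting_time X A \<omega> \<le> enat i"
        unfolding hitting_time_def by (intro INF_lower) auto
      with that \<open>i \<le> n\<close> show False by (metis enat_ord_simps(1) leD order_trans)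
    qed
    show "enat n < hitting_time X A \<omega>" if "\<forall>i\<le>n. X i \<omega> \<notin> A"
    proof -
      have "enat (Suc n) \<le> hitting_time X A \<omega>"
        unfolding hitting_time_def
        using that by (intro INF_greatest) (auto simp: not_less_eq_eq)
      then show ?thesis by (simp add: Suc_ile_eq)
    qed
  qed
  have not_hit: "{\<omega> \<in> space M. \<forall>i\<le>n. X i \<omega> \<notin> A} \<in> sets M" for n
    using assms by (intro sets.sets_Collect) auto
  \<comment> \<open>An extended natural number is determined by the naturals below it, so measurability of the
     hitting time, including on the event that it is infinite, reduces to the tail events.\<close>
  have determined: "a = b" if "\<And>n. enat n < a \<longleftrightarrow> enat n < b" for a b :: enat
    using that by (cases a; cases b) (metis enat_ord_simps(2,4) less_irrefl nat_neq_iff)+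
  have "hitting_time X A \<in> M \<rightarrow>\<^sub>M count_space UNIV"
  proof (subst measurable_count_space_eq2_countable, intro conjI ballI)
    fix a
    have "hitting_time X A -` {a} \<inter> space M
        = {\<omega> \<in> space M. \<forall>n. enat n < a \<longleftrightarrow> (\<forall>i\<le>n. X i \<omega> \<notin> A)}"
      by (auto simp: less_iff[symmetric] intro: determined)
    also have "\<dots> \<in> sets M"
    proof (rule sets.sets_Collect_countable_All)
      show "{\<omega> \<in> space M. enat n < a \<longleftrightarrow> (\<forall>i\<le>n. X i \<omega> \<notin> A)} \<in> sets M" for n
      proof (cases "enat n < a")
        case True
        then show ?thesis using not_hit[of n] by (simp only: simp_thms)
      next
        case False
        then show ?thesis
          using sets.sets_Collect_neg[OF not_hit[of n]] by (simp only: simp_thms)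
      qed
    qed
    finally show "hitting_time X A -` {a} \<inter> space M \<in> sets M" .
  qed auto
  from nn_integral_enat_function[OF this] show ?thesis by (simp add: less_iff)
qed

locale graph_random_walk = graph G + prob_space M
  for G :: "('a, 'b) pre_digraph" and M :: "'w measure" +
  fixes v\<^sub>0 :: 'a and X :: "nat \<Rightarrow> 'w \<Rightarrow> 'a"
  assumes random_walk: "random_walk G v\<^sub>0 M X"
begin

lemma in_verts: "\<omega> \<in> space M \<Longrightarrow> X k \<omega> \<in> verts G"
  using random_walk measurable_space[of "X k" M "count_space (verts G)" \<omega>]
  by (auto simp: random_walk_def)

lemma events [measurable]: "{\<omega> \<in> space M. X k \<omega> \<in> A} \<in> sets M"
proof -
  have X: "X k \<in> M \<rightarrow>\<^sub>M count_space (verts G)"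
    using random_walk by (auto simp: random_walk_def)
  have "{\<omega> \<in> space M. X k \<omega> \<in> A} = X k -` (A \<inter> verts G) \<inter> space M"
    using in_verts by auto
  also have "\<dots> \<in> sets M" using X by (rule measurable_sets) auto
  finally show ?thesis .
qed

lemma events_eq [measurable]: "Measurable.pred M (\<lambda>\<omega>. X k \<omega> = x)"
  using events[of k "{x}"] by (simp add: pred_def)

lemma events_notin [measurable]: "Measurable.pred M (\<lambda>\<omega>. X k \<omega> \<notin> A)"
  using events[of k "- A"] by (simp add: pred_def)

text \<open>
  The transition law of the walk is only given for complete histories \<open>X\<^sub>0 = h 0, \<dots>, X\<^sub>n = h n\<close>.
  An event that depends on the past through avoidance of \<open>A\<close> is therefore split into the finitely
  many histories compatible with it. Taking \<open>h\<close> to be extensional on \<open>{..n}\<close> makes each history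
  occur once. The predicate \<open>Q\<close> will be trivial or specify the next step.
\<close>

lemma prob_history_sum:
  assumes [measurable]: "Measurable.pred M Q"
  shows "\<P>(\<omega> in M. (\<forall>i\<le>n. X i \<omega> \<notin> A) \<and> X n \<omega> = v \<and> Q \<omega>)
    = (\<Sum>h \<in> {h \<in> {..n} \<rightarrow>\<^sub>E (verts G - A). h n = v}. \<P>(\<omega> in M. (\<forall>i\<le>n. X i \<omega> = h i) \<and> Q \<omega>))"
    (is "_ = sum _ ?H")
proof -
  let ?B = "\<lambda>h. {\<omega> \<in> space M. (\<forall>i\<le>n. X i \<omega> = h i) \<and> Q \<omega>}"
  have "finite ({..n} \<rightarrow>\<^sub>E (verts G - A))" by (intro finite_PiE) auto
  then have "finite ?H" by simp
  have "{\<omega> \<in> space M. (\<forall>i\<le>n. X i \<omega> \<notin> A) \<and> X n \<omega> = v \<and> Q \<omega>} = (\<Union>h\<in>?H. ?B h)"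
  proof (intro subset_antisym subsetI)
    fix \<omega> assume "\<omega> \<in> {\<omega> \<in> space M. (\<forall>i\<le>n. X i \<omega> \<notin> A) \<and> X n \<omega> = v \<and> Q \<omega>}"
    then show "\<omega> \<in> (\<Union>h\<in>?H. ?B h)"
      by (intro UN_I[of "\<lambda>i\<in>{..n}. X i \<omega>"]) (auto simp: in_verts)
  qed (auto simp: PiE_iff)
  moreover have "disjoint_family_on ?B ?H"
  proof (unfold disjoint_family_on_def, intro ballI impI)
    fix g h assume "g \<in> ?H" "h \<in> ?H" "g \<noteq> h"
    then obtain i where "i \<le> n" "g i \<noteq> h i"
      by (metis (no_types, lifting) PiE_ext atMost_iff mem_Collect_eq)
    then show "?B g \<inter> ?B h = {}" by auto
  qed
  ultimately show ?thesis
    using \<open>finite ?H\<close> by (simp add: finite_measure_finite_Union image_subset_iff)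
qed

text \<open>
  The transition probability depends on the history only through its last vertex \<open>v\<close>, so it
  factors out of the sum over all histories ending in \<open>v\<close>.
\<close>

lemma markov_step:
  assumes "v \<notin> A" "neighbors G v \<noteq> {}"
  shows "\<P>(\<omega> in M. (\<forall>i\<le>n. X i \<omega> \<notin> A) \<and> X n \<omega> = v \<and> X (Suc n) \<omega> = y)
    = \<P>(\<omega> in M. (\<forall>i\<le>n. X i \<omega> \<notin> A) \<and> X n \<omega> = v) * (indicator (neighbors G v) y / real (out_degree G v))"
    (is "_ = _ * ?q")
proof -
  let ?H = "{h \<in> {..n} \<rightarrow>\<^sub>E (verts G - A). h n = v}"
  have step: "\<P>(\<omega> in M. (\<forall>i\<le>n. X i \<omega> = h i) \<and> X (Suc n) \<omega> = y)
      = \<P>(\<omega> in M. (\<forall>i\<le>n. X i \<omega> = h i) \<and> True) * ?q" if "h \<in> ?H" for h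
  proof (cases "\<P>(\<omega> in M. \<forall>i\<le>n. X i \<omega> = h i) > 0")
    case True
    then have "\<P>(\<omega> in M. X (Suc n) \<omega> = y \<bar> \<forall>i\<le>n. X i \<omega> = h i)
        = pmf (pmf_of_set (neighbors G (h n))) y"
      using random_walk by (simp add: random_walk_def)
    also have "\<dots> = ?q"
      using that assms finite_neighbors by (simp add: card_neighbors)
    finally show ?thesis
      using True by (simp add: cond_prob_def field_simps conj_commute)
  next
    \<comment> \<open>Histories of probability zero have no transition law, but contribute zero to both sides.\<close>
    case False
    then have "\<P>(\<omega> in M. \<forall>i\<le>n. X i \<omega> = h i) = 0"
      using measure_nonneg[of M "{\<omega> \<in> space M. \<forall>i\<le>n. X i \<omega> = h i}"] by linarith
    moreover have "\<P>(\<omega> in M. (\<forall>i\<le>n. X i \<omega> = h i) \<and> X (Suc n) \<omega> = y)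
        \<le> \<P>(\<omega> in M. \<forall>i\<le>n. X i \<omega> = h i)"
      by (intro finite_measure_mono) auto
    ultimately show ?thesis
      using measure_nonneg[of M "{\<omega> \<in> space M. (\<forall>i\<le>n. X i \<omega> = h i) \<and> X (Suc n) \<omega> = y}"] by simp
  qed
  have "\<P>(\<omega> in M. (\<forall>i\<le>n. X i \<omega> \<notin> A) \<and> X n \<omega> = v)
      = (\<Sum>h\<in>?H. \<P>(\<omega> in M. (\<forall>i\<le>n. X i \<omega> = h i) \<and> True))"
    using prob_history_sum[of "\<lambda>_. True"] by simp
  then show ?thesis
    by (simp only: prob_history_sum[of "\<lambda>\<omega>. X (Suc n) \<omega> = y"] events_eq sum_distrib_right step
        cong: sum.cong)
qed

lemma prob_partition:
  assumes [measurable]: "Measurable.pred M Q"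
  shows "\<P>(\<omega> in M. Q \<omega>) = (\<Sum>v\<in>verts G. \<P>(\<omega> in M. Q \<omega> \<and> X n \<omega> = v))"
proof -
  have "{\<omega> \<in> space M. Q \<omega>} = (\<Union>v\<in>verts G. {\<omega> \<in> space M. Q \<omega> \<and> X n \<omega> = v})"
    using in_verts by auto
  moreover have "disjoint_family_on (\<lambda>v. {\<omega> \<in> space M. Q \<omega> \<and> X n \<omega> = v}) (verts G)"
    by (auto simp: disjoint_family_on_def)
  ultimately show ?thesis by (simp add: finite_measure_finite_Union image_subset_iff)
qed

text \<open>
  Each step taken outside \<open>A\<close> costs at least one unit of potential on average, and the potential cannot
  become negative. Vertices outside \<open>A\<close> must have a neighbour, as otherwise their transition
  law would be the uniform distribution on the empty set.
\<close>

theorem expected_hitting_time_le_potential: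
  fixes \<phi> :: "'a \<Rightarrow> real"
  assumes nonneg: "\<And>v. v \<in> verts G \<Longrightarrow> 0 \<le> \<phi> v"
    and nonempty: "\<And>v. v \<in> verts G - A \<Longrightarrow> neighbors G v \<noteq> {}"
    and drift: "\<And>v. v \<in> verts G - A \<Longrightarrow>
      (\<Sum>x\<in>neighbors G v. \<phi> x) / real (out_degree G v) \<le> \<phi> v - 1"
    and v\<^sub>0: "v\<^sub>0 \<in> verts G"
  shows "(\<integral>\<^sup>+ \<omega>. ennreal_of_enat (hitting_time X A \<omega>) \<partial>M) \<le> ennreal (\<phi> v\<^sub>0)"
proof -
  define p where "p n v = \<P>(\<omega> in M. (\<forall>i\<le>n. X i \<omega> \<notin> A) \<and> X n \<omega> = v)" for n v
  define s where "s n = \<P>(\<omega> in M. \<forall>i\<le>n. X i \<omega> \<notin> A)" for n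
  define \<Phi> where "\<Phi> n = (\<Sum>v\<in>verts G. p n v * \<phi> v)" for n
  have p_nonneg: "0 \<le> p n v" for n v by (simp add: p_def)
  have p_outside: "p n v = 0" if "v \<in> A" for n v
  proof -
    have "{\<omega> \<in> space M. (\<forall>i\<le>n. X i \<omega> \<notin> A) \<and> X n \<omega> = v} = {}" using that by auto
    then show ?thesis unfolding p_def by (metis measure_empty)
  qed
  have s_eq: "s n = (\<Sum>v\<in>verts G. p n v)" for n
    unfolding s_def p_def by (rule prob_partition) measurable
  \<comment> \<open>Only an inequality: paths that enter \<open>A\<close> at time \<open>Suc n\<close> are lost on the left.\<close>
  have p_Suc: "p (Suc n) y \<le> (\<Sum>v\<in>verts G - A. p n v * (indicator (neighbors G v) y / real (out_degree G v)))"
    for n y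
  proof -
    have "p (Suc n) y \<le> \<P>(\<omega> in M. (\<forall>i\<le>n. X i \<omega> \<notin> A) \<and> X (Suc n) \<omega> = y)"
      unfolding p_def by (intro finite_measure_mono) auto
    also have "\<dots> = (\<Sum>v\<in>verts G. \<P>(\<omega> in M. ((\<forall>i\<le>n. X i \<omega> \<notin> A) \<and> X (Suc n) \<omega> = y) \<and> X n \<omega> = v))"
      by (rule prob_partition) measurable
    also have "\<dots> = (\<Sum>v\<in>verts G - A. \<P>(\<omega> in M. (\<forall>i\<le>n. X i \<omega> \<notin> A) \<and> X n \<omega> = v \<and> X (Suc n) \<omega> = y))"
    proof (intro sum.mono_neutral_cong_right ballI)
      fix v assume "v \<in> verts G - (verts G - A)"
      then have "{\<omega> \<in> space M. ((\<forall>i\<le>n. X i \<omega> \<notin> A) \<and> X (Suc n) \<omega> = y) \<and> X n \<omega> = v} = {}" by auto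
      then show "\<P>(\<omega> in M. ((\<forall>i\<le>n. X i \<omega> \<notin> A) \<and> X (Suc n) \<omega> = y) \<and> X n \<omega> = v) = 0"
        by (metis measure_empty)
    qed (auto intro!: arg_cong[where f = prob])
    also have "\<dots> = (\<Sum>v\<in>verts G - A. p n v * (indicator (neighbors G v) y / real (out_degree G v)))"
      unfolding p_def by (intro sum.cong refl markov_step) (use nonempty in auto)
    finally show ?thesis .
  qed
  have descent: "\<Phi> (Suc n) + s n \<le> \<Phi> n" for n
  proof -
    have "\<Phi> (Suc n) \<le> (\<Sum>y\<in>verts G. \<Sum>v\<in>verts G - A.
        p n v * (indicator (neighbors G v) y / real (out_degree G v)) * \<phi> y)"
      unfolding \<Phi>_def sum_distrib_right[symmetric]
      by (intro sum_mono mult_right_mono p_Suc nonneg)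
    also have "\<dots> = (\<Sum>v\<in>verts G - A. p n v *
        ((\<Sum>y\<in>verts G. indicator (neighbors G v) y * \<phi> y) / real (out_degree G v)))"
      by (subst sum.swap) (simp only: sum_distrib_left sum_divide_distrib mult_ac
          times_divide_eq_left times_divide_eq_right)
    also have "\<dots> = (\<Sum>v\<in>verts G - A. p n v * ((\<Sum>y\<in>neighbors G v. \<phi> y) / real (out_degree G v)))"
    proof -
      have "(\<Sum>y\<in>verts G. indicator (neighbors G v) y * \<phi> y) = (\<Sum>y\<in>neighbors G v. \<phi> y)" for v
        using neighbors_subset_verts
        by (intro sum.mono_neutral_cong_right) (auto simp: indicator_def)
      then show ?thesis by simp
    qed
    also have "\<dots> \<le> (\<Sum>v\<in>verts G - A. p n v * (\<phi> v - 1))"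
      by (intro sum_mono mult_left_mono drift p_nonneg)
    also have "\<dots> = (\<Sum>v\<in>verts G. p n v * (\<phi> v - 1))"
      by (intro sum.mono_neutral_left) (auto simp: p_outside)
    also have "\<dots> = \<Phi> n - s n"
      by (simp add: \<Phi>_def s_eq sum_subtractf algebra_simps)
    finally show ?thesis by simp
  qed
  have \<Phi>_0: "\<Phi> 0 \<le> \<phi> v\<^sub>0"
  proof -
    have "p 0 v = 0" if "v \<noteq> v\<^sub>0" for v
    proof -
      have "AE \<omega> in M. X 0 \<omega> = v\<^sub>0" using random_walk by (simp add: random_walk_def)
      then have "AE \<omega> in M. \<not> ((\<forall>i\<le>0. X i \<omega> \<notin> A) \<and> X 0 \<omega> = v)"
        using that by (auto elim: eventually_mono)
      then show ?thesis unfolding p_def by (subst prob_eq_0) (auto simp: pred_def[symmetric])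
    qed
    then have "\<Phi> 0 = p 0 v\<^sub>0 * \<phi> v\<^sub>0"
      unfolding \<Phi>_def using v\<^sub>0 by (subst sum.remove[of _ v\<^sub>0]) auto
    also have "\<dots> \<le> 1 * \<phi> v\<^sub>0"
      unfolding p_def by (intro mult_right_mono nonneg v\<^sub>0 prob_le_1)
    finally show ?thesis by simp
  qed
  have \<Phi>_nonneg: "0 \<le> \<Phi> n" for n
    unfolding \<Phi>_def by (intro sum_nonneg mult_nonneg_nonneg p_nonneg nonneg)
  have telescoped: "(\<Sum>n<k. s n) + \<Phi> k \<le> \<phi> v\<^sub>0" for k
  proof (induction k)
    case (Suc k)
    then show ?case using descent[of k] by simp
  qed (use \<Phi>_0 in simp)
  have partial: "(\<Sum>n<k. s n) \<le> \<phi> v\<^sub>0" for k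
    using telescoped[of k] \<Phi>_nonneg[of k] by simp
  have "(\<integral>\<^sup>+ \<omega>. ennreal_of_enat (hitting_time X A \<omega>) \<partial>M) = (\<Sum>n. ennreal (s n))"
    unfolding s_def by (simp add: nn_integral_hitting_time emeasure_eq_measure)
  also have "\<dots> = (SUP k. \<Sum>n<k. ennreal (s n))"
    by (rule suminf_eq_SUP)
  also have "\<dots> \<le> ennreal (\<phi> v\<^sub>0)"
    by (intro SUP_least) (auto simp: s_def intro!: ennreal_leI partial[unfolded s_def])
  finally show ?thesis .
qed

end

section \<open>The quadratic potential\<close>

text \<open>
  With distances measured from \<open>v\<^sub>0\<close>, the initial value of the potential is the claimed bound. The factor \<open>max_degree G\<close> turns the
  guaranteed gain \<open>1/deg(v)\<close> of the mean squared distance into a drop of at least \<open>1\<close>.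
\<close>

theorem theorem1:
  fixes G :: "('a, 'b) pre_digraph" and v\<^sub>0 :: 'a
    and M :: "'w measure" and X :: "nat \<Rightarrow> 'w \<Rightarrow> 'a"
  assumes "graph G"
    and "Digraph_Component.connected G"
    and "card (verts G) \<ge> 2"
    and "v\<^sub>0 \<in> verts G"
    and "random_walk G v\<^sub>0 M X"
  shows "(\<integral>\<^sup>+ \<omega>. ennreal_of_enat (hitting_time X (boundary G) \<omega>) \<partial>M)
           \<le> ennreal (real (max_degree G) * (diam G)\<^sup>2)"
proof -
  interpret graph G by fact
  interpret prob_space M using assms(5) by (simp add: random_walk_def)
  interpret graph_random_walk G M v\<^sub>0 X by unfold_locales fact
  have sc: "strongly_connected G"
    using symmetric_connected_imp_strongly_connected sym_arcs assms(2) by blast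
  define \<phi> where "\<phi> v = real (max_degree G) * ((diam G)\<^sup>2 - (gdist G v v\<^sub>0)\<^sup>2)" for v
  have "{gdist G u v | u v. u \<in> verts G \<and> v \<in> verts G}
      = (\<lambda>(u, v). gdist G u v) ` (verts G \<times> verts G)" by auto
  then have "finite {gdist G u v | u v. u \<in> verts G \<and> v \<in> verts G}" by simp
  then have le_diam: "gdist G v v\<^sub>0 \<le> diam G" if "v \<in> verts G" for v
    unfolding diam_def using that assms(4) by (intro Max_ge) auto
  have gdist_nonneg: "0 \<le> gdist G v v\<^sub>0" if "v \<in> verts G" for v
  proof -
    have "v \<rightarrow>\<^sup>*\<^bsub>G\<^esub> v\<^sub>0" using sc that assms(4) by auto
    then show ?thesis using gdist_awalk_bounds(2) by (auto simp: reachable_awalk)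
  qed
  have nonempty: "neighbors G v \<noteq> {}" if "v \<in> verts G" for v
    using exists_neighbor_at_other_distance[OF sc assms(3) that that] by auto
  have "(\<integral>\<^sup>+ \<omega>. ennreal_of_enat (hitting_time X (boundary G) \<omega>) \<partial>M) \<le> ennreal (\<phi> v\<^sub>0)"
  proof (rule expected_hitting_time_le_potential)
    fix v assume v: "v \<in> verts G"
    then show "0 \<le> \<phi> v"
      unfolding \<phi>_def using le_diam gdist_nonneg by (simp add: power_mono)
  next
    fix v assume v: "v \<in> verts G - boundary G"
    let ?n = "real (out_degree G v)" and ?S = "\<Sum>x\<in>neighbors G v. (gdist G x v\<^sub>0)\<^sup>2"
    have n: "0 < ?n"
      using nonempty[of v] v finite_neighbors card_neighbors[of v]
      by (metis DiffD1 card_gt_0_iff of_nat_0_less_iff)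
    have "?n \<le> max_degree G"
      unfolding max_degree_def using v by (simp add: Max_ge)
    then have ratio: "1 \<le> real (max_degree G) / ?n" using n by simp
    have growth: "?n * (gdist G v v\<^sub>0)\<^sup>2 + 1 \<le> ?S"
      using sum_squared_gdist_neighbors_ge[OF sc assms(3) _ _ assms(4)] v by auto
    have "(\<Sum>x\<in>neighbors G v. \<phi> x) / ?n = real (max_degree G) * (?n * (diam G)\<^sup>2 - ?S) / ?n"
      by (simp add: \<phi>_def sum_subtractf card_neighbors flip: sum_distrib_left)
    also have "\<dots> \<le> real (max_degree G) * (?n * (diam G)\<^sup>2 - (?n * (gdist G v v\<^sub>0)\<^sup>2 + 1)) / ?n"
      using growth n by (intro divide_right_mono mult_left_mono) auto
    also have "\<dots> = \<phi> v - real (max_degree G) / ?n"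
      using n by (simp add: \<phi>_def field_simps)
    also have "\<dots> \<le> \<phi> v - 1" using ratio by simp
    finally show "(\<Sum>x\<in>neighbors G v. \<phi> x) / ?n \<le> \<phi> v - 1" .
  qed (use nonempty assms(4) in auto)
  then show ?thesis by (simp add: \<phi>_def gdist_self assms(4))
qed

end
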